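(* Let $H$ be an infinite dimensional separable Hilbert space and let $I=\mathbb N=\{1,2,3,\dots\}$. Let $w=\{w_j\}_{j\in I}$ be a frame sequence in $H$ with canonical dual $\widetilde w=\{\widetilde w_j\}_{j\in I}$, $f=\{f_i\}_{i\in I}$ a frame for $H$ and $u=\{u_i\}_{i\in I}$ a Parseval frame for $H$. Let $y_i:=\sum_{k\in I}\langle u_k,f_i\rangle\widetilde w_k$, $i\in I$, and let $f'=\{f'_i\}_{i\in I}$ be the sequence with $f'_i=f_{(i+1)/2}$ if $i$ is odd and $f'_i=0$ if $i$ is even. Then the following are equivalent: (a) $\{y_i\}_{i\in I}$ is a Parseval frame for $\overline{span}\{w_j\}_{j\in I}$ and $(G(\widetilde w,w)^t-\mathcal I)G(u,f)=\mathbf 0$, i.e. $\sum_{k\in I}\langle\widetilde w_k,w_j\rangle\langle u_k,f_i\rangle=\langle u_j,f_i\rangle$ for all $i,j\in I$; (b) there exists a Parseval frame $v=\{v_i\}_{i\in I}$ for $H$ (not necessarily an orthonormal basis) such that $w$ is a weak R-dual of $f'$ with respect to $u$ and $v$.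
   Context: Inner products are linear in the first variable. A sequence $\{f_i\}_{i\in I}$ in $H$ is a frame for $H$ if there are $0<A\le B<\infty$ with $A\|x\|^2\le\sum_{i}|\langle x,f_i\rangle|^2\le B\|x\|^2$ for all $x\in H$; it is a Parseval frame if one can take $A=B=1$. A sequence is a frame sequence if it is a frame for its closed linear span. The canonical dual of a frame sequence $w$ is $\widetilde w_j=S_w^{-1}w_j$, where $S_w g=\sum_j\langle g,w_j\rangle w_j$ is the frame operator of $w$ on $\overline{span}\{w_j\}$. For sequences $g,h$ in $H$ indexed by $I$, $G(g,h)$ denotes the matrix $(\langle g_i,h_j\rangle)_{i,j\in I}$, $G(g,h)^t$ its transpose, and $\mathcal I$ the infinite identity matrix. Weak R-dual: let $u,v$ be Parseval frames for $H$ and $f$ a sequence in $H$ such that $\sum_{i\in I}|\langle f_i,u_j\rangle|^2<\infty$ for all $j\in I$ and $(G(v,v)^t-\mathcal I)G(f,u)=\mathbf 0$ (i.e. $\sum_{k}\langle v_k,v_i\rangle\langle f_k,u_j\rangle=\langle f_i,u_j\rangle$ for all $i,j$). Then the sequence $w=\{w_j\}_{j\in I}$ given by $w_j=\sum_{i\in I}\langle f_i,u_j\rangle v_i$ is called the weak R-dual of $f$ with respect to $u$ and $v$. (So "$w$ is a weak R-dual of $f$ with respect to $u$ and $v$" means that all these conditions hold.) *)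

theory Defs
  imports "HOL-Analysis.Analysis"
begin

section \<open>Complex Hilbert spaces\<close>

text \<open>
  Both superclass operations \<open>scaleR\<close> and \<open>inner\<close> are determined by the complex structure, by the
  axioms \<open>scaleR_scaleC\<close> and \<open>inner_eq_Re_cinner\<close>; in particular
  \<open>norm x = sqrt (Re (cinner x x))\<close>.  Positive definiteness of \<open>cinner\<close> is inherited from
  \<open>real_inner\<close>.  The inner product is linear in the first argument.
\<close>

class complex_inner = real_inner +
  fixes scaleC :: "complex \<Rightarrow> 'a \<Rightarrow> 'a" (infixr "*\<^sub>C" 75)
    and cinner :: "'a \<Rightarrow> 'a \<Rightarrow> complex"
  assumes scaleC_add_right: "a *\<^sub>C (x + y) = a *\<^sub>C x + a *\<^sub>C y"
    and scaleC_add_left: "(a + b) *\<^sub>C x = a *\<^sub>C x + b *\<^sub>C x"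
    and scaleC_scaleC: "a *\<^sub>C (b *\<^sub>C x) = (a * b) *\<^sub>C x"
    and scaleR_scaleC: "r *\<^sub>R x = complex_of_real r *\<^sub>C x"
    and cinner_commute: "cinner x y = cnj (cinner y x)"
    and cinner_add_left: "cinner (x + y) z = cinner x z + cinner y z"
    and cinner_scaleC_left: "cinner (a *\<^sub>C x) y = a * cinner x y"
    and inner_eq_Re_cinner: "inner x y = Re (cinner x y)"

class complex_hilbert = complex_inner + complete_space

lemma scaleC_one: "1 *\<^sub>C x = (x :: 'a :: complex_inner)"
  using scaleR_scaleC[of 1 x] by simp

global_interpretation complex_vector:
  vector_space "scaleC :: complex \<Rightarrow> 'a \<Rightarrow> 'a :: complex_inner"
  defines cspan = complex_vector.span
  by unfold_locales (simp_all add: scaleC_add_right scaleC_add_left scaleC_scaleC scaleC_one)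

lemma cinner_self: "cinner x x = complex_of_real ((norm (x :: 'a :: complex_inner))\<^sup>2)"
proof -
  have "Im (cinner x x) = 0"
    using arg_cong[OF cinner_commute[of x x], of Im] by simp
  then show ?thesis
    by (simp add: complex_eq_iff power2_norm_eq_inner inner_eq_Re_cinner)
qed

instantiation complex :: complex_hilbert
begin

definition scaleC_complex :: "complex \<Rightarrow> complex \<Rightarrow> complex"
  where "scaleC_complex a x = a * x"

definition cinner_complex :: "complex \<Rightarrow> complex \<Rightarrow> complex"
  where "cinner_complex x y = x * cnj y"

instance
  by intro_classes
    (simp_all add: scaleC_complex_def cinner_complex_def algebra_simps scaleR_conv_of_real
      inner_complex_def)

end

definition infinite_dimensional :: "'a::complex_inner itself \<Rightarrow> bool"
  where "infinite_dimensional _ \<longleftrightarrow> \<not> (\<exists>B :: 'a set. finite B \<and> cspan B = UNIV)"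

section \<open>Frames\<close>

text \<open>
  Sequences are functions of which only the values on the index set \<open>I\<close> matter.  All series are
  unordered sums.
\<close>

definition frame_with_bounds ::
  "'i set \<Rightarrow> ('i \<Rightarrow> 'a::complex_inner) \<Rightarrow> 'a set \<Rightarrow> real \<Rightarrow> real \<Rightarrow> bool"
  where "frame_with_bounds I f W A B \<longleftrightarrow>
    (\<forall>i\<in>I. f i \<in> W) \<and>
    (\<forall>x\<in>W. (\<lambda>i. (cmod (cinner x (f i)))\<^sup>2) summable_on I \<and>
      A * (norm x)\<^sup>2 \<le> (\<Sum>\<^sub>\<infinity>i\<in>I. (cmod (cinner x (f i)))\<^sup>2) \<and>
      (\<Sum>\<^sub>\<infinity>i\<in>I. (cmod (cinner x (f i)))\<^sup>2) \<le> B * (norm x)\<^sup>2)"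

definition is_frame :: "'i set \<Rightarrow> ('i \<Rightarrow> 'a::complex_inner) \<Rightarrow> 'a set \<Rightarrow> bool"
  where "is_frame I f W \<longleftrightarrow> (\<exists>A B. 0 < A \<and> A \<le> B \<and> frame_with_bounds I f W A B)"

definition parseval_frame :: "'i set \<Rightarrow> ('i \<Rightarrow> 'a::complex_inner) \<Rightarrow> 'a set \<Rightarrow> bool"
  where "parseval_frame I f W \<longleftrightarrow> frame_with_bounds I f W 1 1"

definition closed_span :: "'i set \<Rightarrow> ('i \<Rightarrow> 'a::complex_inner) \<Rightarrow> 'a set"
  where "closed_span I w = closure (cspan (w ` I))"

definition frame_sequence :: "'i set \<Rightarrow> ('i \<Rightarrow> 'a::complex_inner) \<Rightarrow> bool"
  where "frame_sequence I w \<longleftrightarrow> is_frame I w (closed_span I w)"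

definition frame_operator :: "'i set \<Rightarrow> ('i \<Rightarrow> 'a::complex_inner) \<Rightarrow> 'a \<Rightarrow> 'a"
  where "frame_operator I w g = (\<Sum>\<^sub>\<infinity>j\<in>I. cinner g (w j) *\<^sub>C w j)"

text \<open>The frame operator of a frame sequence is inverted on the closed span, where it is bijective.\<close>

definition canonical_dual :: "'i set \<Rightarrow> ('i \<Rightarrow> 'a::complex_inner) \<Rightarrow> 'i \<Rightarrow> 'a"
  where "canonical_dual I w j = inv_into (closed_span I w) (frame_operator I w) (w j)"

section \<open>Infinite matrices\<close>

definition gram :: "('i \<Rightarrow> 'a::complex_inner) \<Rightarrow> ('i \<Rightarrow> 'a) \<Rightarrow> 'i \<Rightarrow> 'i \<Rightarrow> complex"
  where "gram g h i j = cinner (g i) (h j)"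

definition mtranspose :: "('i \<Rightarrow> 'i \<Rightarrow> complex) \<Rightarrow> 'i \<Rightarrow> 'i \<Rightarrow> complex"
  where "mtranspose M i j = M j i"

definition mident :: "'i \<Rightarrow> 'i \<Rightarrow> complex"
  where "mident i j = (if i = j then 1 else 0)"

text \<open>\<open>M N = 0\<close>, including convergence of the series defining each entry of the product.\<close>

definition mprod_zero ::
  "'i set \<Rightarrow> ('i \<Rightarrow> 'i \<Rightarrow> complex) \<Rightarrow> ('i \<Rightarrow> 'i \<Rightarrow> complex) \<Rightarrow> bool"
  where "mprod_zero I M N \<longleftrightarrow> (\<forall>i\<in>I. \<forall>j\<in>I. ((\<lambda>k. M i k * N k j) has_sum 0) I)"

lemma mprod_zero_gram_iff:
  "mprod_zero I (mtranspose (gram a b) - mident) (gram c d) \<longleftrightarrow>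
    (\<forall>i\<in>I. \<forall>j\<in>I. ((\<lambda>k. cinner (a k) (b i) * cinner (c k) (d j)) has_sum cinner (c i) (d j)) I)"
proof -
  have "((\<lambda>k. (mtranspose (gram a b) - mident) i k * gram c d k j) has_sum 0) I \<longleftrightarrow>
      ((\<lambda>k. cinner (a k) (b i) * cinner (c k) (d j)) has_sum cinner (c i) (d j)) I"
    if i: "i \<in> I" for i j
  proof -
    let ?p = "\<lambda>k. cinner (a k) (b i) * cinner (c k) (d j)"
    let ?q = "\<lambda>k. mident i k * cinner (c k) (d j)"
    have eq: "(\<lambda>k. (mtranspose (gram a b) - mident) i k * gram c d k j) = (\<lambda>k. ?p k - ?q k)"
      by (simp add: mtranspose_def gram_def algebra_simps)
    have q: "(?q has_sum cinner (c i) (d j)) I"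
    proof -
      have "(?q has_sum (\<Sum>k\<in>{i}. ?q k)) {i}"
        by (rule has_sum_finite) simp
      then have "(?q has_sum (\<Sum>k\<in>{i}. ?q k)) I"
        using i by (subst has_sum_cong_neutral[of "{i}" I ?q ?q]) (auto simp: mident_def)
      then show ?thesis by (simp add: mident_def)
    qed
    show ?thesis
    proof
      assume "((\<lambda>k. (mtranspose (gram a b) - mident) i k * gram c d k j) has_sum 0) I"
      from has_sum_add[OF this[unfolded eq] q] show "(?p has_sum cinner (c i) (d j)) I" by simp
    next
      assume "(?p has_sum cinner (c i) (d j)) I"
      moreover have "((\<lambda>k. - ?q k) has_sum - cinner (c i) (d j)) I"
        using q by (simp only: has_sum_uminus minus_minus)
      ultimately have "((\<lambda>k. ?p k + - ?q k) has_sum (cinner (c i) (d j) + - cinner (c i) (d j))) I"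
        by (rule has_sum_add)
      then show "((\<lambda>k. (mtranspose (gram a b) - mident) i k * gram c d k j) has_sum 0) I"
        unfolding eq by simp
    qed
  qed
  then show ?thesis by (simp add: mprod_zero_def)
qed

section \<open>Weak R-duals\<close>

definition weak_R_dual ::
  "'i set \<Rightarrow> ('i \<Rightarrow> 'a::complex_inner) \<Rightarrow> ('i \<Rightarrow> 'a) \<Rightarrow> ('i \<Rightarrow> 'a) \<Rightarrow> ('i \<Rightarrow> 'a) \<Rightarrow> bool"
  where "weak_R_dual I f u v w \<longleftrightarrow>
    parseval_frame I u UNIV \<and> parseval_frame I v UNIV \<and>
    (\<forall>j\<in>I. (\<lambda>i. (cmod (cinner (f i) (u j)))\<^sup>2) summable_on I) \<and>
    mprod_zero I (mtranspose (gram v v) - mident) (gram f u) \<and>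
    (\<forall>j\<in>I. ((\<lambda>i. cinner (f i) (u j) *\<^sub>C v i) has_sum w j) I)"

end

theory Submission
  imports Defs
begin

text \<open>
  Let \<open>W\<close> be the closed span of \<open>w\<close>, with orthogonal projection \<open>P x = (\<Sum>k. \<langle>x, w k\<rangle> dual k)\<close>.  Condition
  (a) says that \<open>y\<close> is a Parseval frame for \<open>W\<close> with \<open>\<langle>y i, w j\<rangle> = \<langle>u j, f i\<rangle>\<close>.  Given (a), interlace
  \<open>y\<close> with the Parseval frame \<open>u i - P (u i)\<close> of the orthogonal complement of \<open>W\<close> to obtain \<open>v\<close>.
  Conversely, the matrix condition in (b) says \<open>\<langle>w j, v i\<rangle> = \<langle>f' i, u j\<rangle>\<close>, so the even terms of \<open>v\<close>
  are orthogonal to \<open>W\<close> and the odd ones project to \<open>y\<close>.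
\<close>

section \<open>Inner products and unordered sums\<close>

lemma cinner_add_right: "cinner x (y + z) = cinner x y + cinner x z"
  by (metis cinner_add_left cinner_commute complex_cnj_add)

lemma cinner_scaleC_right: "cinner x (a *\<^sub>C y) = cnj a * cinner x y"
  by (metis cinner_commute cinner_scaleC_left complex_cnj_mult)

lemma cinner_zero_left [simp]: "cinner 0 x = 0"
  using cinner_add_left[of 0 0 x] by simp

lemma cinner_zero_right [simp]: "cinner x 0 = 0"
  using cinner_add_right[of x 0 0] by simp

lemma cinner_minus_left: "cinner (- x) y = - cinner x y"
  using cinner_add_left[of x "- x" y] by (simp add: eq_neg_iff_add_eq_0 add.commute)

lemma cinner_diff_left: "cinner (x - y) z = cinner x z - cinner y z"
  using cinner_add_left[of x "- y" z] by (simp add: cinner_minus_left)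

lemma cinner_diff_right: "cinner x (y - z) = cinner x y - cinner x z"
  by (metis cinner_commute cinner_diff_left complex_cnj_diff)

lemma cinner_sum_left: "cinner (\<Sum>i\<in>F. f i) y = (\<Sum>i\<in>F. cinner (f i) y)"
  by (induction F rule: infinite_finite_induct) (simp_all add: cinner_add_left)

lemma cmod_cinner_commute: "cmod (cinner x y) = cmod (cinner y x)"
  by (metis cinner_commute complex_mod_cnj)

lemma norm_scaleC: "norm (a *\<^sub>C x) = cmod a * norm x"
proof -
  have "complex_of_real ((norm (a *\<^sub>C x))\<^sup>2) = complex_of_real ((cmod a * norm x)\<^sup>2)"
    unfolding cinner_self[symmetric] cinner_scaleC_left cinner_scaleC_right
    by (simp add: cinner_self power_mult_distrib complex_norm_square mult.assoc mult.commute
        del: of_real_power)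
  then have "(norm (a *\<^sub>C x))\<^sup>2 = (cmod a * norm x)\<^sup>2"
    by (simp only: of_real_eq_iff)
  then show ?thesis
    by (simp add: power2_eq_iff_nonneg)
qed

lemma cmod_cinner_le: "cmod (cinner x y) \<le> norm x * norm y"
proof (cases "cinner x y = 0")
  case False
  \<comment> \<open>Multiplying \<open>x\<close> by this unimodular factor makes the inner product
    real and nonnegative, so the Cauchy-Schwarz inequality for \<open>inner\<close> gives the
    complex one.\<close>
  define a where "a = cnj (cinner x y) / cmod (cinner x y)"
  have a: "cmod a = 1"
    using False by (simp add: a_def norm_divide)
  have "cinner (a *\<^sub>C x) y = cmod (cinner x y)"
    using False complex_norm_square[of "cinner x y"]
    by (simp add: a_def cinner_scaleC_left field_simps power2_eq_square)
  then have "cmod (cinner x y) = inner (a *\<^sub>C x) y"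
    by (simp add: inner_eq_Re_cinner)
  also have "\<dots> \<le> norm (a *\<^sub>C x) * norm y"
    by (rule norm_cauchy_schwarz)
  finally show ?thesis
    by (simp add: norm_scaleC a)
qed simp

lemma bounded_linear_cinner_left: "bounded_linear (\<lambda>x. cinner x y)"
  by (rule bounded_linear_intro[where K = "norm y"])
    (simp_all add: cinner_add_left scaleR_scaleC cinner_scaleC_left cmod_cinner_le
      scaleC_complex_def)

lemmas has_sum_cinner_left = has_sum_bounded_linear[OF bounded_linear_cinner_left]

lemma norm_diff_sq:
  "(norm (x - y))\<^sup>2 = (norm x)\<^sup>2 - 2 * Re (cinner x y) + (norm (y :: 'a :: complex_inner))\<^sup>2"
  by (simp add: power2_norm_eq_inner inner_diff_left inner_diff_right inner_commute
      flip: inner_eq_Re_cinner)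

section \<open>Convergence of unordered sums in complete spaces\<close>

lemma summable_on_Cauchy_tail:
  fixes f :: "'i \<Rightarrow> 'a::{real_normed_vector, complete_space}"
  assumes tail: "\<And>e. e > 0 \<Longrightarrow> \<exists>F0. finite F0 \<and> F0 \<subseteq> A \<and>
    (\<forall>F. finite F \<and> F \<subseteq> A \<and> F \<inter> F0 = {} \<longrightarrow> norm (sum f F) < e)"
  shows "f summable_on A"
proof -
  have "\<exists>P. eventually P (finite_subsets_at_top A) \<and>
      (\<forall>F F'. P F \<and> P F' \<longrightarrow> dist (sum f F) (sum f F') < e)" if "e > 0" for e
  proof -
    from tail[OF half_gt_zero[OF \<open>e > 0\<close>]] obtain F0 where F0: "finite F0" "F0 \<subseteq> A"
      and small: "\<forall>F. finite F \<and> F \<subseteq> A \<and> F \<inter> F0 = {} \<longrightarrow> norm (sum f F) < e / 2"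
      by (elim exE conjE)
    \<comment> \<open>Two finite sets containing \<open>F0\<close> have sums within e/2 of
      \<open>sum f F0\<close>, hence within e of each other: the net of partial sums is
      Cauchy.\<close>
    have near: "dist (sum f F) (sum f F0) < e / 2" if "finite F" "F0 \<subseteq> F" "F \<subseteq> A" for F
    proof -
      have "sum f F - sum f F0 = sum f (F - F0)"
        using that F0 by (simp add: sum_diff)
      then show ?thesis
        using small[rule_format, of "F - F0"] that by (auto simp: dist_norm)
    qed
    let ?P = "\<lambda>F. finite F \<and> F0 \<subseteq> F \<and> F \<subseteq> A"
    have "eventually ?P (finite_subsets_at_top A)"
      unfolding eventually_finite_subsets_at_top using F0 by (intro exI[of _ F0]) simp
    moreover have "dist (sum f F) (sum f F') < e" if "?P F \<and> ?P F'" for F F'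
      using that by (elim conjE, intro dist_triangle_half_l[OF near near])
    ultimately show ?thesis
      by (intro exI[of _ ?P] conjI allI impI)
  qed
  then have "cauchy_filter (filtermap (sum f) (finite_subsets_at_top A))"
    by (simp add: cauchy_filter_metric_filtermap)
  moreover have "filtermap (sum f) (finite_subsets_at_top A) \<noteq> bot"
    by (simp add: filtermap_bot_iff)
  ultimately obtain L where "(sum f \<longlongrightarrow> L) (finite_subsets_at_top A)"
    using complete_uniform[where S = "UNIV :: 'a set"] complete_UNIV
    unfolding filterlim_def by (metis principal_UNIV top_greatest)
  then show ?thesis
    by (auto simp: summable_on_def has_sum_def)
qed

text \<open>Serves both to place limits of series in a closed subspace and to pass norm estimates
  from partial sums to the limit.\<close>

lemma has_sum_closed:
  assumes "(f has_sum s) A" "closed W"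
    and "\<And>F. finite F \<Longrightarrow> F \<subseteq> A \<Longrightarrow> sum f F \<in> W"
  shows "s \<in> W"
proof (rule Lim_in_closed_set[OF assms(2)])
  show "(sum f \<longlongrightarrow> s) (finite_subsets_at_top A)"
    using assms(1) by (simp add: has_sum_def)
qed (auto intro: assms(3) eventually_finite_subsets_at_top_weakI)

text \<open>Think of \<open>p\<close> as squared coefficients. Its tails are small, and
  \<open>bound\<close> turns this into smallness of the tails of \<open>f\<close>, without absolute
  convergence of \<open>f\<close>.\<close>

lemma summable_on_square_bounded:
  fixes f :: "'i \<Rightarrow> 'a::{real_normed_vector, complete_space}"
  assumes "p summable_on A" "\<And>i. i \<in> A \<Longrightarrow> 0 \<le> p i" "0 \<le> C"
    and bound: "\<And>F. finite F \<Longrightarrow> F \<subseteq> A \<Longrightarrow> (norm (sum f F))\<^sup>2 \<le> C * sum p F"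
  shows "f summable_on A"
    and "(norm (infsum f A))\<^sup>2 \<le> C * infsum p A"
proof -
  show sm: "f summable_on A"
  proof (rule summable_on_Cauchy_tail)
    fix e :: real
    assume "e > 0"
    \<comment> \<open>Dividing by \<open>C + 1\<close> instead of \<open>C\<close> covers
      \<open>C = 0\<close> and makes the last estimate C d < (C + 1) d strict.\<close>
    define d where "d = e\<^sup>2 / (C + 1)"
    have d: "d > 0"
      using \<open>e > 0\<close> \<open>0 \<le> C\<close> by (simp add: d_def)
    obtain F0 where F0: "finite F0" "F0 \<subseteq> A" "dist (sum p F0) (infsum p A) \<le> d / 2"
      using infsum_finite_approximation[OF assms(1), of "d / 2"] d by auto
    have "norm (sum f F) < e" if F: "finite F" "F \<subseteq> A" "F \<inter> F0 = {}" for F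
    proof -
      \<comment> \<open>Since \<open>F\<close> avoids \<open>F0\<close>, its mass is part of what
        \<open>F0\<close> misses of the total, which is at most d/2.\<close>
      have "sum p F + sum p F0 = sum p (F \<union> F0)"
        using F F0 by (simp add: sum.union_disjoint)
      also have "\<dots> \<le> infsum p A"
        using F F0 assms by (intro finite_sum_le_infsum) auto
      finally have "sum p F < d"
        using F0(3) d unfolding dist_real_def by linarith
      have "(norm (sum f F))\<^sup>2 \<le> C * sum p F"
        using bound F by simp
      also have "\<dots> \<le> C * d"
        using \<open>sum p F < d\<close> \<open>0 \<le> C\<close> by (simp add: mult_left_mono)
      also have "\<dots> < (C + 1) * d"
        using d by simp
      also have "\<dots> = e\<^sup>2"
        using \<open>0 \<le> C\<close> by (simp add: d_def)
      finally show ?thesis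
        using \<open>e > 0\<close> by (simp add: power2_less_imp_less)
    qed
    then show "\<exists>F0. finite F0 \<and> F0 \<subseteq> A \<and>
        (\<forall>F. finite F \<and> F \<subseteq> A \<and> F \<inter> F0 = {} \<longrightarrow> norm (sum f F) < e)"
      using F0 by blast
  qed
  have "infsum f A \<in> {z. (norm z)\<^sup>2 \<le> C * infsum p A}"
  proof (rule has_sum_closed[OF has_sum_infsum[OF sm]])
    show "closed {z :: 'a. (norm z)\<^sup>2 \<le> C * infsum p A}"
      by (intro closed_Collect_le continuous_intros)
    fix F
    assume F: "finite F" "F \<subseteq> A"
    have "sum p F \<le> infsum p A"
      using F assms by (intro finite_sum_le_infsum) auto
    then have "C * sum p F \<le> C * infsum p A"
      using \<open>0 \<le> C\<close> by (rule mult_left_mono)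
    then show "sum f F \<in> {z. (norm z)\<^sup>2 \<le> C * infsum p A}"
      using bound[OF F] by simp
  qed
  then show "(norm (infsum f A))\<^sup>2 \<le> C * infsum p A"
    by simp
qed

section \<open>Splitting sums over the positive integers by parity\<close>

lemma has_sum_odd_even:
  fixes h :: "nat \<Rightarrow> 'a::topological_comm_monoid_add"
  assumes "((\<lambda>i. h (2 * i - 1)) has_sum a) {1..}" "((\<lambda>i. h (2 * i)) has_sum b) {1..}"
  shows "(h has_sum (a + b)) {1..}"
proof -
  have "(h has_sum a) {k. odd k}"
    using assms(1)
    by (subst has_sum_reindex_bij_witness[where T = "{1..}" and i = "\<lambda>i. 2 * i - 1"
          and j = "\<lambda>k. (k + 1) div 2" and h = "\<lambda>i. h (2 * i - 1)"]) (auto elim!: oddE)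
  moreover have "(h has_sum b) {k. even k \<and> 1 \<le> k}"
    using assms(2)
    by (subst has_sum_reindex_bij_witness[where T = "{1..}" and i = "\<lambda>i. 2 * i"
          and j = "\<lambda>k. k div 2" and h = "\<lambda>i. h (2 * i)"]) (auto elim!: evenE)
  ultimately have "(h has_sum (a + b)) ({k. odd k} \<union> {k. even k \<and> 1 \<le> k})"
    by (rule has_sum_Un_disjoint) auto
  moreover have "{k. odd k} \<union> {k. even k \<and> 1 \<le> k} = {1::nat..}"
    by (auto intro: odd_pos Suc_leI)
  ultimately show ?thesis by simp
qed

text \<open>Inserting zeros at even places does not affect the sum. One direction of the theorem
  passes from the odd places to all places, the other goes back.\<close>

lemma has_sum_odd_iff:
  fixes h :: "nat \<Rightarrow> 'a::topological_comm_monoid_add"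
  assumes "\<And>i. 1 \<le> i \<Longrightarrow> h (2 * i) = 0"
  shows "((\<lambda>i. h (2 * i - 1)) has_sum a) {1..} \<longleftrightarrow> (h has_sum a) {1..}"
proof -
  have "((\<lambda>i. h (2 * i - 1)) has_sum a) {1..} \<longleftrightarrow> (h has_sum a) {k. odd k}"
    by (rule has_sum_reindex_bij_witness[where j = "\<lambda>i. 2 * i - 1" and i = "\<lambda>k. (k + 1) div 2"])
      (auto elim!: oddE)
  also have "\<dots> \<longleftrightarrow> (h has_sum a) {1..}"
    by (rule has_sum_cong_neutral) (auto elim!: evenE intro: assms odd_pos Suc_leI)
  finally show ?thesis .
qed

section \<open>Bessel sequences\<close>

text \<open>The lower frame bound is split off so that a frame and its canonical dual can both be
  instances.\<close>

locale bessel_sequence =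
  fixes I :: "'i set" and g :: "'i \<Rightarrow> 'a::complex_hilbert" and W :: "'a set" and B :: real
  assumes subspace: "complex_vector.subspace W"
    and closed: "closed W"
    and mem: "i \<in> I \<Longrightarrow> g i \<in> W"
    and coeff_summable: "x \<in> W \<Longrightarrow> (\<lambda>i. (cmod (cinner x (g i)))\<^sup>2) summable_on I"
    and bessel: "x \<in> W \<Longrightarrow> (\<Sum>\<^sub>\<infinity>i\<in>I. (cmod (cinner x (g i)))\<^sup>2) \<le> B * (norm x)\<^sup>2"
    and bound_nonneg: "0 \<le> B"
begin

lemma finite_synthesis_mem: "F \<subseteq> I \<Longrightarrow> (\<Sum>i\<in>F. c i *\<^sub>C g i) \<in> W"
  using subspace mem
  by (intro complex_vector.subspace_sum complex_vector.subspace_scale) auto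

text \<open>For the sum z, expand \<langle>z, z\<rangle> in one argument and apply Cauchy-Schwarz to
  the coefficients. The Bessel bound at z gives \<parallel>z\<parallel>^4 \<le> B C
  \<parallel>z\<parallel>^2, with C the sum of the squared coefficients; then cancel.\<close>

lemma finite_synthesis_bound:
  assumes "finite F" "F \<subseteq> I"
  shows "(norm (\<Sum>i\<in>F. c i *\<^sub>C g i))\<^sup>2 \<le> B * (\<Sum>i\<in>F. (cmod (c i))\<^sup>2)"
proof -
  define z where "z = (\<Sum>i\<in>F. c i *\<^sub>C g i)"
  have "z \<in> W"
    unfolding z_def using assms by (intro finite_synthesis_mem)
  define C where "C = (\<Sum>i\<in>F. (cmod (c i))\<^sup>2)"
  have "C \<ge> 0"
    by (simp add: C_def sum_nonneg)
  have "(norm z)\<^sup>2 = cmod (cinner z z)"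
    by (simp add: cinner_self norm_power)
  also have "cinner z z = (\<Sum>i\<in>F. c i * cinner (g i) z)"
    by (subst (1) z_def) (simp add: cinner_sum_left cinner_scaleC_left)
  also have "cmod \<dots> \<le> (\<Sum>i\<in>F. cmod (c i) * cmod (cinner z (g i)))"
    by (rule sum_norm_le) (simp add: norm_mult cmod_cinner_commute)
  finally have "((norm z)\<^sup>2)\<^sup>2 \<le> (\<Sum>i\<in>F. cmod (c i) * cmod (cinner z (g i)))\<^sup>2"
    by (intro power_mono) auto
  also have "\<dots> \<le> C * (\<Sum>i\<in>F. (cmod (cinner z (g i)))\<^sup>2)"
    unfolding C_def by (rule Cauchy_Schwarz_ineq_sum)
  also have "\<dots> \<le> C * (B * (norm z)\<^sup>2)"
  proof (rule mult_left_mono[OF _ \<open>C \<ge> 0\<close>])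
    have "(\<Sum>i\<in>F. (cmod (cinner z (g i)))\<^sup>2) \<le> (\<Sum>\<^sub>\<infinity>i\<in>I. (cmod (cinner z (g i)))\<^sup>2)"
      using assms coeff_summable[OF \<open>z \<in> W\<close>] by (intro finite_sum_le_infsum) auto
    then show "(\<Sum>i\<in>F. (cmod (cinner z (g i)))\<^sup>2) \<le> B * (norm z)\<^sup>2"
      using bessel[OF \<open>z \<in> W\<close>] by simp
  qed
  finally have le: "(norm z)\<^sup>2 * (norm z)\<^sup>2 \<le> B * C * (norm z)\<^sup>2"
    by (simp only: power2_eq_square mult_ac)
  have "(norm z)\<^sup>2 \<le> B * C"
  proof (cases "z = 0")
    case False
    then have "0 < (norm z)\<^sup>2" by simp
    with le show ?thesis by (rule mult_right_le_imp_le)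
  qed (use \<open>C \<ge> 0\<close> bound_nonneg in simp)
  then show ?thesis
    by (simp add: z_def C_def)
qed

lemma synthesis_summable:
  assumes "(\<lambda>i. (cmod (c i))\<^sup>2) summable_on I"
  shows "(\<lambda>i. c i *\<^sub>C g i) summable_on I"
  by (rule summable_on_square_bounded(1)[OF assms _ bound_nonneg finite_synthesis_bound]) simp

lemma synthesis_bound:
  assumes "(\<lambda>i. (cmod (c i))\<^sup>2) summable_on I"
  shows "(norm (\<Sum>\<^sub>\<infinity>i\<in>I. c i *\<^sub>C g i))\<^sup>2 \<le> B * (\<Sum>\<^sub>\<infinity>i\<in>I. (cmod (c i))\<^sup>2)"
  by (rule summable_on_square_bounded(2)[OF assms _ bound_nonneg finite_synthesis_bound]) simp

lemma synthesis_mem: "((\<lambda>i. c i *\<^sub>C g i) has_sum z) I \<Longrightarrow> z \<in> W"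
  by (rule has_sum_closed[OF _ closed finite_synthesis_mem])

text \<open>The locale assumes this only on \<open>W\<close>; here \<open>x\<close> is arbitrary and
  no projection is available yet. A partial sum C equals \<langle>z, x\<rangle> for the finite
  synthesis z, so C^2 \<le> B C \<parallel>x\<parallel>^2 by the synthesis bound.\<close>

lemma coeff_summable_ambient: "(\<lambda>i. (cmod (cinner x (g i)))\<^sup>2) summable_on I"
proof (rule nonneg_bounded_partial_sums_imp_summable_on)
  have "(\<Sum>i\<in>F. (cmod (cinner x (g i)))\<^sup>2) \<le> B * (norm x)\<^sup>2" if F: "finite F" "F \<subseteq> I" for F
  proof -
    define C where "C = (\<Sum>i\<in>F. (cmod (cinner x (g i)))\<^sup>2)"
    define z where "z = (\<Sum>i\<in>F. cinner x (g i) *\<^sub>C g i)"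
    have "C \<ge> 0"
      by (simp add: C_def sum_nonneg)
    have "cinner z x = complex_of_real C"
      unfolding z_def C_def
      by (simp add: cinner_sum_left cinner_scaleC_left complex_norm_square cinner_commute[symmetric]
          del: of_real_power)
    then have "C = cmod (cinner z x)"
      using \<open>C \<ge> 0\<close> by simp
    also have "\<dots> \<le> norm z * norm x"
      by (rule cmod_cinner_le)
    finally have "C\<^sup>2 \<le> (norm z)\<^sup>2 * (norm x)\<^sup>2"
      using \<open>C \<ge> 0\<close> by (metis power_mono power_mult_distrib)
    also have "\<dots> \<le> B * C * (norm x)\<^sup>2"
      using finite_synthesis_bound[OF F, of "\<lambda>i. cinner x (g i)"]
      by (intro mult_right_mono) (auto simp: z_def C_def)
    finally have "C * C \<le> B * (norm x)\<^sup>2 * C"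
      by (simp add: power2_eq_square mult_ac)
    then show ?thesis
      using \<open>C \<ge> 0\<close> bound_nonneg unfolding C_def[symmetric] by (cases "C = 0") auto
  qed
  then show "\<forall>\<^sub>F F in finite_subsets_at_top I. (\<Sum>i\<in>F. (cmod (cinner x (g i)))\<^sup>2) \<le> B * (norm x)\<^sup>2"
    by (auto intro: eventually_finite_subsets_at_top_weakI)
qed auto

section \<open>The frame operator S of a Bessel sequence\<close>

lemma frame_operator_has_sum: "((\<lambda>i. cinner x (g i) *\<^sub>C g i) has_sum frame_operator I g x) I"
  unfolding frame_operator_def by (intro has_sum_infsum synthesis_summable coeff_summable_ambient)

lemma frame_operator_mem: "frame_operator I g x \<in> W"
  using frame_operator_has_sum by (rule synthesis_mem)

text \<open>With \<open>frame_operator_quadratic\<close> this reads \<parallel>S x\<parallel>^2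
  \<le> B \<langle>S x, x\<rangle>, the form used for the contraction estimate and the Parseval
  expansion.\<close>

lemma frame_operator_norm:
  "(norm (frame_operator I g x))\<^sup>2 \<le> B * (\<Sum>\<^sub>\<infinity>i\<in>I. (cmod (cinner x (g i)))\<^sup>2)"
  unfolding frame_operator_def by (intro synthesis_bound coeff_summable_ambient)

lemma frame_operator_diff:
  "frame_operator I g (x - y) = frame_operator I g x - frame_operator I g y"
proof -
  have "((\<lambda>i. cinner x (g i) *\<^sub>C g i + - (cinner y (g i) *\<^sub>C g i)) has_sum
      (frame_operator I g x + - frame_operator I g y)) I"
    using frame_operator_has_sum by (intro has_sum_add) (simp_all add: has_sum_uminus)
  then have "((\<lambda>i. cinner (x - y) (g i) *\<^sub>C g i) has_sum
      (frame_operator I g x - frame_operator I g y)) I"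
    by (simp add: cinner_diff_left complex_vector.scale_left_diff_distrib)
  then show ?thesis
    using frame_operator_has_sum has_sum_unique by blast
qed

lemma frame_operator_cinner:
  "((\<lambda>i. cinner x (g i) * cinner (g i) y) has_sum cinner (frame_operator I g x) y) I"
  using has_sum_cinner_left[OF frame_operator_has_sum, of x y] by (simp add: cinner_scaleC_left)

text \<open>Conjugating the series for \<langle>S y, x\<rangle> term by term yields the series for
  \<langle>S x, y\<rangle>.\<close>

lemma frame_operator_selfadjoint: "cinner (frame_operator I g x) y = cinner x (frame_operator I g y)"
proof -
  have "((\<lambda>i. cnj (cinner y (g i) * cinner (g i) x)) has_sum cnj (cinner (frame_operator I g y) x)) I"
    using frame_operator_cinner by (simp only: has_sum_cnj_iff)
  then have "((\<lambda>i. cinner x (g i) * cinner (g i) y) has_sum cinner x (frame_operator I g y)) I"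
    by (simp add: mult.commute flip: cinner_commute)
  then show ?thesis
    using frame_operator_cinner has_sum_unique by blast
qed

lemma frame_operator_quadratic:
  "Re (cinner (frame_operator I g x) x) = (\<Sum>\<^sub>\<infinity>i\<in>I. (cmod (cinner x (g i)))\<^sup>2)"
proof -
  have "Re (cinner x (g i) * cinner (g i) x) = (cmod (cinner x (g i)))\<^sup>2" for i
    by (metis cinner_commute complex_norm_square Re_complex_of_real)
  then have "((\<lambda>i. (cmod (cinner x (g i)))\<^sup>2) has_sum Re (cinner (frame_operator I g x) x)) I"
    using has_sum_Re[OF frame_operator_cinner[of x x]] by simp
  then show ?thesis
    by (simp add: infsumI)
qed

end

section \<open>Frames and canonical duals\<close>

locale frame_for_subspace = bessel_sequence +
  fixes A :: real
  assumes lower_pos: "0 < A" and lower_le_upper: "A \<le> B"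
    and lower: "x \<in> W \<Longrightarrow> A * (norm x)\<^sup>2 \<le> (\<Sum>\<^sub>\<infinity>i\<in>I. (cmod (cinner x (g i)))\<^sup>2)"
begin

lemma upper_pos: "0 < B"
  using lower_pos lower_le_upper by simp

text \<open>\<open>x \<mapsto> x - (S x - z) / B\<close> is a contraction, since \<open>\<parallel>S x\<parallel>\<^sup>2 \<le> B \<langle>S x, x\<rangle>\<close>.\<close>

lemma frame_operator_surj:
  assumes "z \<in> W"
  shows "\<exists>x\<in>W. frame_operator I g x = z"
proof -
  define T where "T x = x - (1 / B) *\<^sub>R (frame_operator I g x - z)" for x
  \<comment> \<open>The estimate below gives \<parallel>T x - T y\<parallel>^2 \<le> (1 - A/B)
    \<parallel>x - y\<parallel>^2.\<close>
  define c where "c = sqrt (1 - A / B)"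
  have ratio: "0 < A / B" "A / B \<le> 1"
    using lower_pos upper_pos lower_le_upper by simp_all
  then have "0 \<le> c" "c < 1"
    by (simp_all add: c_def)
  have diff_mem: "x - y \<in> W" if "x \<in> W" "y \<in> W" for x y
    using that subspace by (rule_tac complex_vector.subspace_diff)
  have "\<exists>!x\<in>W. T x = x"
  proof (rule Banach_fix[where c = c])
    show "complete W"
      using closed complete_UNIV complete_closed_subset by blast
    show "W \<noteq> {}" "0 \<le> c" "c < 1"
      using assms \<open>0 \<le> c\<close> \<open>c < 1\<close> by auto
    show "T ` W \<subseteq> W"
    proof (rule image_subsetI)
      fix x
      assume "x \<in> W"
      moreover have "frame_operator I g x - z \<in> W"
        using frame_operator_mem assms by (rule diff_mem)
      ultimately show "T x \<in> W"
        unfolding T_def scaleR_scaleC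
        using diff_mem complex_vector.subspace_scale[OF subspace] by simp
    qed
    fix x y
    assume "x \<in> W" "y \<in> W"
    define h where "h = x - y"
    define S where "S = frame_operator I g h"
    have "h \<in> W"
      using \<open>x \<in> W\<close> \<open>y \<in> W\<close> by (simp add: h_def diff_mem)
    have "T x - T y = h - (1 / B) *\<^sub>R S"
      by (simp add: T_def h_def S_def frame_operator_diff algebra_simps)
    then have "(norm (T x - T y))\<^sup>2 = (norm h)\<^sup>2 - 2 / B * Re (cinner S h) + (norm S)\<^sup>2 / B\<^sup>2"
      by (simp add: norm_diff_sq power_divide flip: inner_eq_Re_cinner) (simp add: inner_commute)
    \<comment> \<open>The quadratic term is absorbed by half of the cross term; the other half meets
      the lower frame bound.\<close>
    also have "(norm S)\<^sup>2 \<le> B * Re (cinner S h)"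
      using frame_operator_norm[of h] by (simp add: S_def frame_operator_quadratic)
    then have "(norm S)\<^sup>2 / B\<^sup>2 \<le> Re (cinner S h) / B"
      using upper_pos by (simp add: field_simps power2_eq_square)
    then have "(norm h)\<^sup>2 - 2 / B * Re (cinner S h) + (norm S)\<^sup>2 / B\<^sup>2
        \<le> (norm h)\<^sup>2 - Re (cinner S h) / B"
      by simp
    also have "A * (norm h)\<^sup>2 / B \<le> Re (cinner S h) / B"
      using lower[OF \<open>h \<in> W\<close>] upper_pos
      by (simp add: S_def frame_operator_quadratic divide_right_mono)
    then have "(norm h)\<^sup>2 - Re (cinner S h) / B \<le> (1 - A / B) * (norm h)\<^sup>2"
      by (simp add: algebra_simps)
    also have "\<dots> = (c * norm h)\<^sup>2"
      using ratio by (simp add: c_def power_mult_distrib)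
    finally have "norm (T x - T y) \<le> c * norm h"
      by (rule power2_le_imp_le) (simp add: \<open>0 \<le> c\<close>)
    then show "dist (T x) (T y) \<le> c * dist x y"
      by (simp add: dist_norm h_def)
  qed
  then obtain x where "x \<in> W" "T x = x" by blast
  then show ?thesis
    using upper_pos by (auto simp: T_def)
qed

section \<open>The inverse frame operator, the canonical dual and the projection onto the
  subspace\<close>

definition inv_frame_operator :: "'b \<Rightarrow> 'b"
  where "inv_frame_operator = inv_into W (frame_operator I g)"

abbreviation dual :: "'a \<Rightarrow> 'b"
  where "dual i \<equiv> inv_frame_operator (g i)"

lemma inv_frame_operator:
  assumes "z \<in> W"
  shows "inv_frame_operator z \<in> W" "frame_operator I g (inv_frame_operator z) = z"
proof -
  have "z \<in> frame_operator I g ` W"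
    using frame_operator_surj[OF assms] by blast
  then show "inv_frame_operator z \<in> W" "frame_operator I g (inv_frame_operator z) = z"
    unfolding inv_frame_operator_def by (auto intro: inv_into_into f_inv_into_f)
qed

text \<open>For the preimage x of z, the lower bound gives A \<parallel>x\<parallel>^2 \<le> Re
  \<langle>z, x\<rangle> \<le> \<parallel>z\<parallel> \<parallel>x\<parallel>.\<close>

lemma inv_frame_operator_norm:
  assumes "z \<in> W"
  shows "norm (inv_frame_operator z) \<le> norm z / A"
proof -
  define x where "x = inv_frame_operator z"
  have x: "x \<in> W" "frame_operator I g x = z"
    using inv_frame_operator[OF assms] by (simp_all add: x_def)
  have "A * (norm x)\<^sup>2 \<le> Re (cinner z x)"
    using lower[OF x(1)] frame_operator_quadratic[of x] x(2) by simp
  also have "\<dots> \<le> norm z * norm x"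
    using complex_Re_le_cmod cmod_cinner_le order_trans by blast
  finally have "(A * norm x) * norm x \<le> norm z * norm x"
    by (simp add: power2_eq_square mult.assoc)
  then have "A * norm x \<le> norm z"
    by (cases "x = 0") auto
  then show ?thesis
    using lower_pos by (simp add: x_def field_simps)
qed

text \<open>Write \<open>x\<close> as S applied to its preimage and move S onto
  \<open>dual i\<close>, where it returns \<open>g i\<close>.\<close>

lemma cinner_dual:
  assumes "x \<in> W" "i \<in> I"
  shows "cinner x (dual i) = cinner (inv_frame_operator x) (g i)"
  using assms inv_frame_operator mem frame_operator_selfadjoint by metis

text \<open>By \<open>cinner_dual\<close> the coefficients are those of the preimage of x against
  \<open>g\<close>; its norm is at most \<parallel>x\<parallel> / A, whence B / A^2.\<close>

lemma bessel_dual: "bessel_sequence I dual W (B / A\<^sup>2)"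
proof
  show "complex_vector.subspace W" "closed W" "0 \<le> B / A\<^sup>2"
    using subspace closed bound_nonneg by simp_all
  show "dual i \<in> W" if "i \<in> I" for i
    using that by (intro inv_frame_operator mem)
  fix x
  assume x: "x \<in> W"
  have eq: "(cmod (cinner x (dual i)))\<^sup>2 = (cmod (cinner (inv_frame_operator x) (g i)))\<^sup>2"
    if "i \<in> I" for i
    using cinner_dual[OF x that] by simp
  show "(\<lambda>i. (cmod (cinner x (dual i)))\<^sup>2) summable_on I"
    using coeff_summable_ambient[of "inv_frame_operator x"] eq
    by (simp cong: summable_on_cong)
  have "(\<Sum>\<^sub>\<infinity>i\<in>I. (cmod (cinner x (dual i)))\<^sup>2) \<le> B * (norm (inv_frame_operator x))\<^sup>2"
    using bessel[OF inv_frame_operator(1)[OF x]] eq by (simp cong: infsum_cong)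
  also have "\<dots> \<le> B * (norm x / A)\<^sup>2"
    using inv_frame_operator_norm[OF x] bound_nonneg by (intro mult_left_mono power_mono) auto
  finally show "(\<Sum>\<^sub>\<infinity>i\<in>I. (cmod (cinner x (dual i)))\<^sup>2) \<le> B / A\<^sup>2 * (norm x)\<^sup>2"
    by (simp add: power_divide)
qed

text \<open>Surjectivity replaces a density argument: y = S t, and every term of the series for
  \<langle>S x, t\<rangle> vanishes.\<close>

lemma orthogonal_if_orthogonal_to_frame:
  assumes "\<And>i. i \<in> I \<Longrightarrow> cinner x (g i) = 0" "y \<in> W"
  shows "cinner x y = 0"
proof -
  define t where "t = inv_frame_operator y"
  have y: "y = frame_operator I g t"
    using inv_frame_operator(2)[OF assms(2)] by (simp add: t_def)
  have "((\<lambda>i. 0) has_sum cinner (frame_operator I g x) t) I"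
    using frame_operator_cinner[of x t] assms(1) by (simp cong: has_sum_cong)
  then have "cinner (frame_operator I g x) t = 0"
    by (rule has_sum_unique[OF _ has_sum_0_simp])
  then show ?thesis
    by (simp add: y frame_operator_selfadjoint)
qed

text \<open>The series is the orthogonal projection of an arbitrary ambient \<open>x\<close>. Paired
  with \<open>g j\<close>, it becomes \<langle>S x, dual j\<rangle> = \<langle>x, g j\<rangle>, so
  the difference is orthogonal to the frame and hence to \<open>W\<close>.\<close>

lemma projection:
  "\<exists>z\<in>W. ((\<lambda>k. cinner x (g k) *\<^sub>C dual k) has_sum z) I \<and> (\<forall>y\<in>W. cinner (x - z) y = 0)"
proof -
  interpret d: bessel_sequence I dual W "B / A\<^sup>2"
    by (rule bessel_dual)
  define z where "z = (\<Sum>\<^sub>\<infinity>k\<in>I. cinner x (g k) *\<^sub>C dual k)"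
  have z: "((\<lambda>k. cinner x (g k) *\<^sub>C dual k) has_sum z) I"
    unfolding z_def by (intro has_sum_infsum d.synthesis_summable coeff_summable_ambient)
  have "cinner (x - z) (g j) = 0" if j: "j \<in> I" for j
  proof -
    \<comment> \<open>Both sides arise from \<langle>dual k, S (dual j)\<rangle> by self-adjointness
      of S.\<close>
    have swap: "cinner (dual k) (g j) = cinner (g k) (dual j)" if "k \<in> I" for k
      using inv_frame_operator(2)[OF mem[OF j]] inv_frame_operator(2)[OF mem[OF that]]
        frame_operator_selfadjoint[of "dual k" "dual j"] by simp
    have "((\<lambda>k. cinner x (g k) * cinner (dual k) (g j)) has_sum cinner z (g j)) I"
      using has_sum_cinner_left[OF z, of "g j"] by (simp add: cinner_scaleC_left)
    then have "((\<lambda>k. cinner x (g k) * cinner (g k) (dual j)) has_sum cinner z (g j)) I"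
      by (simp add: swap cong: has_sum_cong)
    then have "cinner z (g j) = cinner (frame_operator I g x) (dual j)"
      by (rule has_sum_unique[OF _ frame_operator_cinner])
    also have "\<dots> = cinner x (g j)"
      using inv_frame_operator(2)[OF mem[OF j]] by (simp add: frame_operator_selfadjoint)
    finally show ?thesis
      by (simp add: cinner_diff_left)
  qed
  then have "cinner (x - z) y = 0" if "y \<in> W" for y
    using that by (rule orthogonal_if_orthogonal_to_frame)
  with z d.synthesis_mem[OF z] show ?thesis by blast
qed

end

section \<open>Parseval frames and closed spans\<close>

lemma frame_for_subspaceI:
  assumes "complex_vector.subspace W" "closed W" "frame_with_bounds I g W A B" "0 < A" "A \<le> B"
  shows "frame_for_subspace I g W B A"
  using assms by unfold_locales (auto simp: frame_with_bounds_def)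

lemma parseval_frame_iff:
  "parseval_frame I g W \<longleftrightarrow> (\<forall>i\<in>I. g i \<in> W) \<and>
    (\<forall>x\<in>W. ((\<lambda>i. (cmod (cinner x (g i)))\<^sup>2) has_sum (norm x)\<^sup>2) I)"
  unfolding parseval_frame_def frame_with_bounds_def has_sum_iff by (auto intro: antisym)

text \<open>With both bounds 1, \<langle>S x, x\<rangle> = \<parallel>x\<parallel>^2 and
  \<parallel>S x\<parallel>^2 \<le> \<parallel>x\<parallel>^2; expanding \<parallel>S x -
  x\<parallel>^2 leaves at most 0.\<close>

lemma parseval_frame_expansion:
  fixes g :: "'i \<Rightarrow> 'a::complex_hilbert"
  assumes "complex_vector.subspace W" "closed W" "parseval_frame I g W" "x \<in> W"
  shows "((\<lambda>i. cinner x (g i) *\<^sub>C g i) has_sum x) I"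
proof -
  interpret frame_for_subspace I g W 1 1
    using assms by (intro frame_for_subspaceI) (auto simp: parseval_frame_def)
  have sum: "(\<Sum>\<^sub>\<infinity>i\<in>I. (cmod (cinner x (g i)))\<^sup>2) = (norm x)\<^sup>2"
    using bessel[OF \<open>x \<in> W\<close>] lower[OF \<open>x \<in> W\<close>] by simp
  have "(norm (frame_operator I g x - x))\<^sup>2 \<le> 0"
    using frame_operator_norm[of x] frame_operator_quadratic[of x]
    by (simp add: norm_diff_sq sum)
  then show ?thesis
    using frame_operator_has_sum[of x] by simp
qed

text \<open>Scaling and addition are continuous and preserve the span, hence its closure; addition
  is treated as a map on the closure of the product.\<close>

lemma subspace_closed_span: "complex_vector.subspace (closed_span I w)"
proof -
  let ?S = "cspan (w ` I)"
  have "bounded_linear (\<lambda>x :: 'a. c *\<^sub>C x)" for c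
    by (rule bounded_linear_intro[where K = "cmod c"])
      (simp_all add: scaleC_add_right scaleR_scaleC scaleC_scaleC mult.commute norm_scaleC)
  then have cont: "continuous_on T (\<lambda>x :: 'a. c *\<^sub>C x)" for c T
    by (rule bounded_linear.continuous_on[OF _ continuous_on_id])
  have scale: "(\<lambda>x. c *\<^sub>C x) ` closure ?S \<subseteq> closure ?S" for c
  proof (rule image_closure_subset[OF cont closed_closure image_subsetI])
    show "c *\<^sub>C x \<in> closure ?S" if "x \<in> ?S" for x
      using complex_vector.span_scale[OF that] closure_subset by blast
  qed
  have add: "(\<lambda>p. fst p + snd p) ` closure (?S \<times> ?S) \<subseteq> closure ?S"
  proof (rule image_closure_subset[OF _ closed_closure image_subsetI])
    show "continuous_on (closure (?S \<times> ?S)) (\<lambda>p. fst p + snd p)"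
      by (intro continuous_intros)
    show "fst p + snd p \<in> closure ?S" if "p \<in> ?S \<times> ?S" for p
      using that complex_vector.span_add[of "fst p" _ "snd p"] closure_subset by (auto simp: mem_Times_iff)
  qed
  have "0 \<in> closure ?S"
    using complex_vector.span_zero closure_subset by blast
  moreover have "c *\<^sub>C x \<in> closure ?S" if "x \<in> closure ?S" for c x
    using that image_subset_iff[THEN iffD1, OF scale] by blast
  moreover have "x + y \<in> closure ?S" if "x \<in> closure ?S" "y \<in> closure ?S" for x y
    using that add by (simp add: closure_Times image_subset_iff)
  ultimately show ?thesis
    unfolding complex_vector.subspace_def closed_span_def by blast
qed

section \<open>The characterization\<close>

theorem theorem2p11:
  fixes I :: "nat set"
    and w f u y f' :: "nat \<Rightarrow> 'a::complex_hilbert"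
  assumes infdim: "infinite_dimensional TYPE('a)"
    and separable: "separable_space (euclidean :: 'a topology)"
    and I: "I = {1..}"
    and w: "frame_sequence I w"
    and f: "is_frame I f UNIV"
    and u: "parseval_frame I u UNIV"
    and y: "\<And>i. i \<in> I \<Longrightarrow> y i = (\<Sum>\<^sub>\<infinity>k\<in>I. cinner (u k) (f i) *\<^sub>C canonical_dual I w k)"
    and f': "\<And>i. i \<in> I \<Longrightarrow> f' i = (if odd i then f ((i + 1) div 2) else 0)"
  shows "(parseval_frame I y (closed_span I w) \<and>
          mprod_zero I (mtranspose (gram (canonical_dual I w) w) - mident) (gram u f)) \<longleftrightarrow>
         (\<exists>v. parseval_frame I v UNIV \<and> weak_R_dual I f' u v w)"
proof -
  define W where "W = closed_span I w"
  have W: "complex_vector.subspace W" "closed W"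
    by (simp_all add: W_def subspace_closed_span) (simp add: closed_span_def)
  obtain A B where "0 < A" "A \<le> B" "frame_with_bounds I w W A B"
    using w unfolding frame_sequence_def is_frame_def W_def by blast
  then interpret w: frame_for_subspace I w W B A
    using W by (intro frame_for_subspaceI)
  interpret d: bessel_sequence I w.dual W "B / A\<^sup>2"
    by (rule w.bessel_dual)
  have dual: "canonical_dual I w k = w.dual k" for k
    unfolding canonical_dual_def w.inv_frame_operator_def by (simp only: W_def)
  have u_sum: "((\<lambda>i. (cmod (cinner x (u i)))\<^sup>2) has_sum (norm x)\<^sup>2) I" for x
    using u by (simp add: parseval_frame_iff)
  have f_summable: "(\<lambda>i. (cmod (cinner x (f i)))\<^sup>2) summable_on I" for x
    using f by (auto simp: is_frame_def frame_with_bounds_def)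
  \<comment> \<open>The Parseval identity of \<open>u\<close> at \<open>f i\<close> makes the
    coefficients square summable and the dual is Bessel, so the sum defining \<open>y i\<close>
    converges.\<close>
  have y_sum: "((\<lambda>k. cinner (u k) (f i) *\<^sub>C w.dual k) has_sum y i) I" if "i \<in> I" for i
  proof -
    have "(\<lambda>k. (cmod (cinner (u k) (f i)))\<^sup>2) summable_on I"
      using has_sum_imp_summable[OF u_sum[of "f i"]] by (subst cmod_cinner_commute)
    then show ?thesis
      unfolding y[OF that] dual by (intro has_sum_infsum d.synthesis_summable)
  qed
  have y_mem: "y i \<in> W" if "i \<in> I" for i
    using y_sum[OF that] by (rule d.synthesis_mem)
  \<comment> \<open>Pairing the series of \<open>y i\<close> with \<open>w j\<close> shows that the
    matrix series always converges to \<langle>y i, w j\<rangle>; only its value is at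
    issue.\<close>
  have gram_iff: "mprod_zero I (mtranspose (gram (canonical_dual I w) w) - mident) (gram u f) \<longleftrightarrow>
      (\<forall>i\<in>I. \<forall>j\<in>I. cinner (y i) (w j) = cinner (u j) (f i))"
  proof -
    have "((\<lambda>k. cinner (w.dual k) (w j) * cinner (u k) (f i)) has_sum cinner (u j) (f i)) I \<longleftrightarrow>
        cinner (y i) (w j) = cinner (u j) (f i)" if "i \<in> I" for i j
    proof -
      have "((\<lambda>k. cinner (w.dual k) (w j) * cinner (u k) (f i)) has_sum cinner (y i) (w j)) I"
        using has_sum_cinner_left[OF y_sum[OF that], of "w j"]
        by (simp add: cinner_scaleC_left mult.commute)
      then show ?thesis
        by (auto dest: has_sum_unique)
    qed
    then show ?thesis
      unfolding mprod_zero_gram_iff dual by blast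
  qed
  \<comment> \<open>As \<open>I\<close> starts at 1, the truncated difference
    \<open>2 * i - 1\<close> is odd and halving its successor returns \<open>i\<close>.\<close>
  have f'_odd: "f' (2 * i - 1) = f i" and f'_even: "f' (2 * i) = 0" if "i \<in> I" for i
    using that f'[of "2 * i - 1"] f'[of "2 * i"] by (auto simp: I)
  have idx: "2 * i - 1 \<in> I" "2 * i \<in> I" if "i \<in> I" for i
    using that by (auto simp: I)
  show ?thesis
    unfolding gram_iff W_def[symmetric]
  proof
    assume L: "parseval_frame I y W \<and> (\<forall>i\<in>I. \<forall>j\<in>I. cinner (y i) (w j) = cinner (u j) (f i))"
    have "\<forall>x. \<exists>z. z \<in> W \<and> (\<forall>t\<in>W. cinner (x - z) t = 0)"
      using w.projection by blast
    then obtain P where P_mem: "P x \<in> W"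
      and P_orth: "t \<in> W \<Longrightarrow> cinner (x - P x) t = 0" for x t
      by metis
    have P_orth': "cinner t (x - P x) = 0" if "t \<in> W" for x t
      using P_orth[OF that] cinner_commute by (metis complex_cnj_zero)
    \<comment> \<open>The even entries meet the zeros of \<open>f'\<close>, so they contribute
      nothing to \<open>w j\<close>; they only complete \<open>y\<close> to a Parseval frame of the
      whole space.\<close>
    define v where "v k = (if odd k then y ((k + 1) div 2) else u (k div 2) - P (u (k div 2)))" for k
    have v_odd: "v (2 * i - 1) = y i" and v_even: "v (2 * i) = u i - P (u i)" if "i \<in> I" for i
      using that by (auto simp: v_def I)
    have pv: "parseval_frame I v UNIV"
    proof -
      have "((\<lambda>k. (cmod (cinner x (v k)))\<^sup>2) has_sum (norm x)\<^sup>2) I" for x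
      proof -
        have "cinner x (y i) = cinner (P x) (y i)" if "i \<in> I" for i
          using P_orth[OF y_mem[OF that], of x] by (simp add: cinner_diff_left)
        moreover have "((\<lambda>i. (cmod (cinner (P x) (y i)))\<^sup>2) has_sum (norm (P x))\<^sup>2) I"
          using L P_mem by (simp add: parseval_frame_iff)
        ultimately have odd: "((\<lambda>i. (cmod (cinner x (v (2 * i - 1))))\<^sup>2) has_sum (norm (P x))\<^sup>2) I"
          by (simp add: v_odd del: One_nat_def cong: has_sum_cong)
        \<comment> \<open>The complementary projection moves from \<open>u i\<close> to
          \<open>x\<close>, where the Parseval identity of \<open>u\<close> applies to
          \<open>x - P x\<close>.\<close>
        have "cinner x (u i - P (u i)) = cinner (x - P x) (u i)" for i
          using P_orth'[OF P_mem, of x "u i"] P_orth[OF P_mem, of x "u i"]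
          by (simp add: cinner_diff_left cinner_diff_right)
        then have even: "((\<lambda>i. (cmod (cinner x (v (2 * i))))\<^sup>2) has_sum (norm (x - P x))\<^sup>2) I"
          using u_sum[of "x - P x"] by (simp add: v_even cong: has_sum_cong)
        \<comment> \<open>Pythagoras: the odd and even contributions add up to the squared norm of
          \<open>x\<close>.\<close>
        have "cinner x (P x) = complex_of_real ((norm (P x))\<^sup>2)"
          using P_orth[OF P_mem, of x x] by (simp add: cinner_diff_left cinner_self)
        then have "(norm (P x))\<^sup>2 + (norm (x - P x))\<^sup>2 = (norm x)\<^sup>2"
          by (simp add: norm_diff_sq del: of_real_power)
        then show ?thesis
          using has_sum_odd_even[OF odd[unfolded I] even[unfolded I]] by (simp add: I)
      qed
      then show ?thesis
        by (simp add: parseval_frame_iff)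
    qed
    have w_y: "cinner (w j) (y i) = cinner (f i) (u j)" if "i \<in> I" "j \<in> I" for i j
      using L that by (metis cinner_commute)
    have w_sum: "((\<lambda>i. cinner (f' i) (u j) *\<^sub>C v i) has_sum w j) I" if j: "j \<in> I" for j
    proof -
      \<comment> \<open>The Parseval expansion of \<open>w j\<close> in \<open>y\<close> already has
        the coefficients \<langle>f i, u j\<rangle>, by \<open>w_y\<close>.\<close>
      have "((\<lambda>i. cinner (w j) (y i) *\<^sub>C y i) has_sum w j) I"
        using L W j by (intro parseval_frame_expansion[of W] w.mem) auto
      then have "((\<lambda>i. cinner (f' (2 * i - 1)) (u j) *\<^sub>C v (2 * i - 1)) has_sum w j) I"
        using j by (simp add: v_odd f'_odd w_y del: One_nat_def cong: has_sum_cong)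
      then show ?thesis
        using f'_even has_sum_odd_iff[of "\<lambda>i. cinner (f' i) (u j) *\<^sub>C v i" "w j"] by (simp add: I)
    qed
    have f'_summable: "(\<lambda>i. (cmod (cinner (f' i) (u j)))\<^sup>2) summable_on I" for j
    proof -
      have "(\<lambda>i. (cmod (cinner (f' (2 * i - 1)) (u j)))\<^sup>2) summable_on I"
        using f_summable[of "u j"]
        by (simp add: f'_odd cmod_cinner_commute[of "u j"] del: One_nat_def cong: summable_on_cong)
      then show ?thesis
        unfolding summable_on_def
        using f'_even has_sum_odd_iff[of "\<lambda>i. (cmod (cinner (f' i) (u j)))\<^sup>2"] by (simp add: I)
    qed
    \<comment> \<open>At odd places this is \<open>w_y\<close>; at even places both sides are
      0.\<close>
    have w_v: "cinner (w j) (v i) = cinner (f' i) (u j)" if i: "i \<in> I" and j: "j \<in> I" for i j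
    proof -
      obtain m where "m \<in> I" "i = 2 * m - 1 \<or> i = 2 * m"
      proof (cases "even i")
        case True
        then show ?thesis
          using i by (intro that[of "i div 2"]) (auto simp: I)
      next
        case False
        then show ?thesis
          by (intro that[of "(i + 1) div 2"]) (auto simp: I elim!: oddE)
      qed
      then show ?thesis
        using j w_y P_orth'[OF w.mem] by (auto simp: v_odd v_even f'_odd f'_even simp del: One_nat_def)
    qed
    have "mprod_zero I (mtranspose (gram v v) - mident) (gram f' u)"
      unfolding mprod_zero_gram_iff
    proof (intro ballI)
      fix i j
      assume "i \<in> I" "j \<in> I"
      then show "((\<lambda>k. cinner (v k) (v i) * cinner (f' k) (u j)) has_sum cinner (f' i) (u j)) I"
        using has_sum_cinner_left[OF w_sum, of j "v i"]
        by (simp add: cinner_scaleC_left w_v mult.commute)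
    qed
    then show "\<exists>v. parseval_frame I v UNIV \<and> weak_R_dual I f' u v w"
      using pv u w_sum f'_summable unfolding weak_R_dual_def by blast
  next
    assume "\<exists>v. parseval_frame I v UNIV \<and> weak_R_dual I f' u v w"
    then obtain v where pv: "parseval_frame I v UNIV"
      and w_sum: "\<And>j. j \<in> I \<Longrightarrow> ((\<lambda>i. cinner (f' i) (u j) *\<^sub>C v i) has_sum w j) I"
      and gram: "\<And>i j. i \<in> I \<Longrightarrow> j \<in> I \<Longrightarrow>
        ((\<lambda>k. cinner (v k) (v i) * cinner (f' k) (u j)) has_sum cinner (f' i) (u j)) I"
      unfolding weak_R_dual_def mprod_zero_gram_iff by blast
    \<comment> \<open>Pairing the series of \<open>w j\<close> with \<open>v i\<close> produces
      exactly the series in the matrix condition, so the two limits agree.\<close>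
    have v_w: "cinner (v i) (w j) = cinner (u j) (f' i)" if "i \<in> I" "j \<in> I" for i j
    proof -
      have "((\<lambda>k. cinner (v k) (v i) * cinner (f' k) (u j)) has_sum cinner (w j) (v i)) I"
        using has_sum_cinner_left[OF w_sum[OF \<open>j \<in> I\<close>], of "v i"]
        by (simp add: cinner_scaleC_left mult.commute)
      then have "cinner (w j) (v i) = cinner (f' i) (u j)"
        by (rule has_sum_unique[OF _ gram[OF that]])
      then show ?thesis
        by (metis cinner_commute)
    qed
    have even: "cinner (v (2 * i)) x = 0" if "i \<in> I" "x \<in> W" for i x
    proof (rule w.orthogonal_if_orthogonal_to_frame[OF _ \<open>x \<in> W\<close>])
      show "cinner (v (2 * i)) (w j) = 0" if "j \<in> I" for j
        using that idx \<open>i \<in> I\<close> by (simp add: v_w f'_even)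
    qed
    \<comment> \<open>The projection of \<open>v (2 * i - 1)\<close> onto \<open>W\<close> has
      coefficients \<langle>u k, f i\<rangle> by \<open>v_w\<close>, so its series is the one
      defining \<open>y i\<close>.\<close>
    have odd: "cinner (y i) x = cinner (v (2 * i - 1)) x" if i: "i \<in> I" and "x \<in> W" for i x
    proof -
      obtain z where z: "((\<lambda>k. cinner (v (2 * i - 1)) (w k) *\<^sub>C w.dual k) has_sum z) I"
        and orth: "cinner (v (2 * i - 1) - z) x = 0"
        using w.projection[of "v (2 * i - 1)"] \<open>x \<in> W\<close> by blast
      have "((\<lambda>k. cinner (u k) (f i) *\<^sub>C w.dual k) has_sum z) I"
        using z i idx by (simp add: v_w f'_odd del: One_nat_def cong: has_sum_cong)
      then have "z = y i"
        by (rule has_sum_unique[OF _ y_sum[OF i]])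
      then show ?thesis
        using orth by (simp add: cinner_diff_left)
    qed
    have "parseval_frame I y W"
      unfolding parseval_frame_iff
    proof (intro conjI ballI y_mem)
      fix x
      assume x: "x \<in> W"
      \<comment> \<open>On \<open>W\<close> the even terms of the Parseval identity for
        \<open>v\<close> drop out, and in the odd ones \<open>v\<close> may be replaced by
        \<open>y\<close>.\<close>
      have "(\<lambda>k. (cmod (cinner x (v k)))\<^sup>2) (2 * i) = 0" if "1 \<le> i" for i
        using even[OF _ x, of i] that by (simp add: I cmod_cinner_commute[of x])
      then have "((\<lambda>i. (cmod (cinner x (v (2 * i - 1))))\<^sup>2) has_sum (norm x)\<^sup>2) I"
        using pv has_sum_odd_iff[of "\<lambda>k. (cmod (cinner x (v k)))\<^sup>2"]
        by (simp add: parseval_frame_iff I)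
      then show "((\<lambda>i. (cmod (cinner x (y i)))\<^sup>2) has_sum (norm x)\<^sup>2) I"
        using x by (simp add: cmod_cinner_commute[of x] odd del: One_nat_def cong: has_sum_cong)
    qed
    moreover have "cinner (y i) (w j) = cinner (u j) (f i)" if "i \<in> I" "j \<in> I" for i j
      using that idx by (simp add: odd w.mem v_w f'_odd del: One_nat_def)
    ultimately show "parseval_frame I y W \<and>
        (\<forall>i\<in>I. \<forall>j\<in>I. cinner (y i) (w j) = cinner (u j) (f i))"
      by blast
  qed
qed

end
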